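(* The following system of linear equations holds: $$\sum_{i\in\Delta}F_i\,P_{ij}=F_j+\sum_{K\in\mathcal C}f_K\,X_K^{(j)}-\mu_j\qquad\text{for every } j\in\Delta,$$ $$\sum_{i\in\Delta}F_i\,P_{iT_1}=\sum_{K\in\mathcal C}f_K\,\tilde g_{KT}-\mu_{T_1}\qquad\text{for every } T\in\mathcal C,$$ where $T_1$ denotes the first element of $T$.
   Context: Let $(Z_n)_{n\ge1}$ be a time-homogeneous Markov chain with finite state space $\Delta$, initial distribution $\mu_i=P(Z_1=i)$ and one-step transition probabilities $P_{ij}=P(Z_{n+1}=j\mid Z_n=i)$. A pattern is a finite sequence of elements of $\Delta$; for a pattern $K$, $|K|$ is its length and $K=K_1K_2\cdots K_{|K|}$. Let $\mathcal C$ be a finite collection (set) of patterns of length at least $1$. For a pattern $A$, $\tau_A$ is the waiting time until $A$ occurs as a run, i.e. the least $n\ge|A|$ with $(Z_{n-|A|+1},\dots,Z_n)=A$ ($\tau_A=\infty$ if there is none), and $\tau=\min\{\tau_A: A\in\mathcal C\}$. Standing assumptions: (A.1) no pattern in $\mathcal C$ is a subpattern (contiguous block) of another pattern in $\mathcal C$; (A.2) for every $K=K_1\cdots K_m\in\mathcal C$, $P_{K_1K_2}\cdots P_{K_{m-1}K_m}>0$ (an empty product equals $1$); (A.3) $P(\tau<\infty)=1$ and $E(\tau)<\infty$. Notation. For a pattern $K$ and $j\in\Delta$, $X_K^{(j)}=1$ if the last element $K_{|K|}$ equals $j$, and $X_K^{(j)}=0$ otherwise. For patterns $K=K_1\cdots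 K_s$ and $T=T_1\cdots T_t$, $\{KT\}$ is the set of integers $k\in\{1,\dots,\min(s,t)\}$ such that $K_{s-k+1}\cdots K_s=T_1\cdots T_k$. For $i\in\Delta$ and a pattern $K$, $P_{i\to K}=P_{iK_1}P_{K_1K_2}\cdots P_{K_{|K|-1}K_{|K|}}$, and $P_{i\to\phi}=1$ for the empty pattern $\phi$. For $K,T\in\mathcal C$, $$\tilde g_{KT}=\frac{1}{P_{T_1\to T_2\cdots T_{|T|}}}\Big(\sum_{r\in\{KT\},\,1\le r<|T|}P_{T_r\to T_{r+1}\cdots T_{|T|}}+\varepsilon_{KT}\Big),$$ where $\varepsilon_{KT}=1$ if $K=T$ and $\varepsilon_{KT}=0$ if $K\ne T$. For $i\in\Delta$, $F_i=\sum_{n\ge1}P(Z_n=i,\ \tau>n)$ (the mean time spent at $i$ before $\tau$); for $K\in\mathcal C$, $f_K=\sum_{n\ge1}P(\tau=\tau_K=n)=P(\tau=\tau_K<\infty)$. *)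

theory Defs
  imports "HOL-Probability.Probability" "HOL-Library.Sublist"
begin

text \<open>The state space is the finite type \<open>'a\<close>; time starts at 1, so \<open>Z 0\<close> is unconstrained.
  The last assumption combines the Markov property with time homogeneity: the law of the next
  state given any history of positive probability is the row of \<open>P\<close> at the current state.
  Rows of states that are never visited are not determined by \<open>Z\<close>, hence the explicit
  requirement that \<open>P\<close> be a stochastic matrix.\<close>

locale homogeneous_markov_chain = prob_space M
  for M :: "'w measure" +
  fixes Z :: "nat \<Rightarrow> 'w \<Rightarrow> 'a::finite"
    and \<mu> :: "'a \<Rightarrow> real"
    and P :: "'a \<Rightarrow> 'a \<Rightarrow> real"
  assumes Z_measurable: "\<And>n. n \<ge> 1 \<Longrightarrow> Z n \<in> measurable M (count_space UNIV)"
    and initial: "\<And>i. \<mu> i = \<P>(\<omega> in M. Z 1 \<omega> = i)"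
    and P_nonneg: "\<And>i j. 0 \<le> P i j"
    and P_row_sum: "\<And>i. (\<Sum>j\<in>UNIV. P i j) = 1"
    and markov: "\<And>n x j. n \<ge> 1 \<Longrightarrow> \<P>(\<omega> in M. \<forall>k\<in>{1..n}. Z k \<omega> = x k) > 0 \<Longrightarrow>
        \<P>(\<omega> in M. Z (Suc n) \<omega> = j \<bar> \<forall>k\<in>{1..n}. Z k \<omega> = x k) = P (x n) j"

definition occurs_at :: "(nat \<Rightarrow> 'w \<Rightarrow> 'a) \<Rightarrow> 'a list \<Rightarrow> 'w \<Rightarrow> nat \<Rightarrow> bool" where
  "occurs_at Z A \<omega> n \<longleftrightarrow>
     length A \<le> n \<and> map (\<lambda>k. Z k \<omega>) [n - length A + 1 ..< n + 1] = A"

text \<open>In \<^typ>\<open>enat\<close> the infimum of a nonempty set is its least element and the infimum of the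
  empty set is \<open>\<infinity>\<close>.\<close>

definition waiting_time :: "(nat \<Rightarrow> 'w \<Rightarrow> 'a) \<Rightarrow> 'a list \<Rightarrow> 'w \<Rightarrow> enat" where
  "waiting_time Z A \<omega> = (INF n\<in>{n. occurs_at Z A \<omega> n}. enat n)"

definition first_waiting_time :: "(nat \<Rightarrow> 'w \<Rightarrow> 'a) \<Rightarrow> 'a list set \<Rightarrow> 'w \<Rightarrow> enat" where
  "first_waiting_time Z C \<omega> = (INF A\<in>C. waiting_time Z A \<omega>)"

text \<open>\<open>path_prob P i K\<close> is $P_{i \to K}$; for a nonempty pattern \<open>K\<close>, the product
  $P_{K_1K_2} \cdots P_{K_{m-1}K_m}$ is \<open>path_prob P (hd K) (tl K)\<close>.\<close>

primrec path_prob :: "('a \<Rightarrow> 'a \<Rightarrow> real) \<Rightarrow> 'a \<Rightarrow> 'a list \<Rightarrow> real" where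
  "path_prob P i [] = 1"
| "path_prob P i (k # ks) = P i k * path_prob P k ks"

definition ends_in :: "'a list \<Rightarrow> 'a \<Rightarrow> real" where
  "ends_in K j = (if last K = j then 1 else 0)"

definition overlaps :: "'a list \<Rightarrow> 'a list \<Rightarrow> nat set" where
  "overlaps K T =
     {k \<in> {1..min (length K) (length T)}. drop (length K - k) K = take k T}"

text \<open>List indices start at 0, so $T_r$ is \<open>T ! (r - 1)\<close> and
  $T_{r+1} \cdots T_{|T|}$ is \<open>drop r T\<close>.\<close>

definition g_tilde :: "('a \<Rightarrow> 'a \<Rightarrow> real) \<Rightarrow> 'a list \<Rightarrow> 'a list \<Rightarrow> real" where
  "g_tilde P K T =
     1 / path_prob P (hd T) (tl T) *
     ((\<Sum>r\<in>{r \<in> overlaps K T. 1 \<le> r \<and> r < length T}. path_prob P (T ! (r - 1)) (drop r T))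
      + (if K = T then 1 else 0))"

text \<open>The sums over times \<open>n \<ge> 1\<close> are indexed by \<open>n - 1\<close>.  The series for \<open>mean_time\<close>
  converges when $E(\tau) < \infty$, being dominated by $\sum_n P(\tau > n)$; the one for
  \<open>stop_prob\<close> always converges, its terms being probabilities of disjoint events.\<close>

definition mean_time :: "'w measure \<Rightarrow> (nat \<Rightarrow> 'w \<Rightarrow> 'a) \<Rightarrow> 'a list set \<Rightarrow> 'a \<Rightarrow> real" where
  "mean_time M Z C i =
     (\<Sum>n. \<P>(\<omega> in M. Z (Suc n) \<omega> = i \<and> first_waiting_time Z C \<omega> > enat (Suc n)))"

definition stop_prob :: "'w measure \<Rightarrow> (nat \<Rightarrow> 'w \<Rightarrow> 'a) \<Rightarrow> 'a list set \<Rightarrow> 'a list \<Rightarrow> real" where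
  "stop_prob M Z C K =
     (\<Sum>n. \<P>(\<omega> in M. first_waiting_time Z C \<omega> = waiting_time Z K \<omega>
                       \<and> waiting_time Z K \<omega> = enat (Suc n)))"

end

theory Submission
  imports Defs
begin

text \<open>
  Write \<open>\<tau>\<close> for the first waiting time of \<open>C\<close> and \<open>h n\<close> for the list of the first \<open>n\<close> states.
  Both systems of equations come from computing, in two ways, the sum over \<open>n\<close> of the probability
  that \<open>\<tau> > n\<close> and that the states at times \<open>n + 1, n + 2, \<dots>\<close> spell a given nonempty block \<open>B\<close>.

  Looking backwards from the block (\<open>block_prob_sums\<close>): conditioning on the state at time \<open>n\<close>, the
  Markov property turns the term for \<open>n \<ge> 1\<close> into
  $\sum_i P(Z_n = i, \tau > n)\, P_{i \to B}$, and the term for \<open>n = 0\<close> is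
  $\mu_{B_1} P_{B_1 \to B_2 \cdots}$. The sum is
  $(\mu_{B_1} + \sum_i F_i P_{i B_1})\, P_{B_1 \to B_2 \cdots}$.

  Looking forwards, from the moment when \<open>C\<close> is first hit:

  \<^item> For a single state \<open>B = [j]\<close> (\<open>prob_step_split\<close>), either \<open>\<tau>\<close> exceeds \<open>n + 1\<close>, which contributes
    $F_j$ in total, or \<open>\<tau> = n + 1\<close> and the unique pattern \<open>K\<close> that ends there has last
    state \<open>j\<close>. This is the balance equation for the mean occupation times.

  \<^item> For a pattern \<open>B = T\<close> of \<open>C\<close> (\<open>prob_block_split\<close>), \<open>\<tau>\<close> cannot exceed the end of the block, so
    \<open>\<tau> = n + r\<close> for some \<open>r\<close> between 1 and the length of \<open>T\<close>. Because no pattern is contained in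
    another, exactly one pattern \<open>K\<close> ends at that time, and it reaches back at least to the
    beginning of the block, which means that \<open>r\<close> is an overlap of \<open>K\<close> with \<open>T\<close>. By the
    Markov property the remaining states of \<open>T\<close> contribute the factor
    $P_{T_r \to T_{r+1} \cdots}$. Summed over \<open>n\<close>, the total is
    $\sum_K f_K \sum_r P_{T_r \to T_{r+1} \cdots}$, where the overlap of full length occurs for
    \<open>K = T\<close> only; after division by $P_{T_1 \to T_2 \cdots}$ the inner sum is $\tilde g_{KT}$.

  All events concern finite histories: \<open>\<tau> > n\<close> says that \<open>h n\<close> contains no pattern of \<open>C\<close>, and
  \<open>\<tau> = \<tau>\<^sub>K = n\<close> says that \<open>h n\<close> ends in \<open>K\<close> while \<open>h (n - 1)\<close> contains no pattern. The
  combinatorics therefore takes place on lists. The finite mean of \<open>\<tau>\<close> enters as the convergence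
  of $\sum_n P(\tau > n)$, which dominates every series involved.
\<close>

section \<open>Waiting times in terms of finite histories\<close>

definition history :: "(nat \<Rightarrow> 'w \<Rightarrow> 'a) \<Rightarrow> nat \<Rightarrow> 'w \<Rightarrow> 'a list" where
  "history Z n \<omega> = map (\<lambda>k. Z k \<omega>) [1..<Suc n]"

definition avoids :: "'a list set \<Rightarrow> 'a list \<Rightarrow> bool" where
  "avoids C xs \<longleftrightarrow> (\<forall>A\<in>C. \<not> sublist A xs)"

definition completes :: "'a list set \<Rightarrow> 'a list \<Rightarrow> 'a list \<Rightarrow> bool" where
  "completes C K xs \<longleftrightarrow> suffix K xs \<and> avoids C (butlast xs)"

lemma length_history [simp]: "length (history Z n \<omega>) = n"
  by (simp add: history_def)

lemma history_0 [simp]: "history Z 0 \<omega> = []"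
  by (simp add: history_def)

lemma history_Suc: "history Z (Suc n) \<omega> = history Z n \<omega> @ [Z (Suc n) \<omega>]"
  by (simp add: history_def)

lemma history_nth: "k < n \<Longrightarrow> history Z n \<omega> ! k = Z (Suc k) \<omega>"
  by (simp add: history_def del: upt_Suc)

lemma last_history: "n \<ge> 1 \<Longrightarrow> last (history Z n \<omega>) = Z n \<omega>"
  by (cases n) (simp_all add: history_Suc)

lemma take_history: "m \<le> n \<Longrightarrow> take m (history Z n \<omega>) = history Z m \<omega>"
  by (rule nth_equalityI) (simp_all add: history_nth)

lemma butlast_history [simp]: "butlast (history Z (Suc n) \<omega>) = history Z n \<omega>"
  by (simp add: history_Suc)

lemma history_eq_iff:
  "length xs = n \<Longrightarrow> history Z n \<omega> = xs \<longleftrightarrow> (\<forall>k\<in>{1..n}. Z k \<omega> = xs ! (k - 1))"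
proof
  assume "length xs = n" and "\<forall>k\<in>{1..n}. Z k \<omega> = xs ! (k - 1)"
  then show "history Z n \<omega> = xs"
    by (intro nth_equalityI) (simp_all add: history_nth)
next
  assume "history Z n \<omega> = xs"
  then show "\<forall>k\<in>{1..n}. Z k \<omega> = xs ! (k - 1)"
    by (auto simp: history_nth)
qed

lemma occurs_at_iff_suffix: "occurs_at Z A \<omega> n \<longleftrightarrow> suffix A (history Z n \<omega>)"
proof -
  have *: "map (\<lambda>k. Z k \<omega>) [n - length A + 1 ..< n + 1] = drop (n - length A) (history Z n \<omega>)"
    by (simp add: history_def drop_map del: upt_Suc)
  show ?thesis
    unfolding occurs_at_def *
  proof
    assume "length A \<le> n \<and> drop (n - length A) (history Z n \<omega>) = A"
    then show "suffix A (history Z n \<omega>)"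
      by (metis suffix_drop)
  next
    assume "suffix A (history Z n \<omega>)"
    then obtain ps where ps: "history Z n \<omega> = ps @ A"
      by (auto simp: suffix_def)
    have "n = length ps + length A"
      using arg_cong[OF ps, of length] by simp
    then show "length A \<le> n \<and> drop (n - length A) (history Z n \<omega>) = A"
      unfolding ps by simp
  qed
qed

lemma sublist_history_iff:
  "sublist A (history Z n \<omega>) \<longleftrightarrow> (\<exists>m\<le>n. suffix A (history Z m \<omega>))"
proof
  assume "sublist A (history Z n \<omega>)"
  then obtain ps ss where *: "history Z n \<omega> = ps @ A @ ss"
    by (auto simp: sublist_def)
  define m where "m = length ps + length A"
  have mn: "m \<le> n"
    using arg_cong[OF *, of length] by (simp add: m_def)
  have "history Z m \<omega> = ps @ A"
    using take_history[OF mn, of Z \<omega>] by (simp add: * m_def)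
  then show "\<exists>m\<le>n. suffix A (history Z m \<omega>)"
    using mn by (auto simp: suffix_def)
next
  assume "\<exists>m\<le>n. suffix A (history Z m \<omega>)"
  then show "sublist A (history Z n \<omega>)"
    by (metis take_history sublist_take sublist_order.order.trans suffix_imp_sublist)
qed

text \<open>Together with \<open>stops_with_pattern_iff\<close> below, this replaces waiting times by conditions on
  the list of states seen so far: a pattern has occurred by time \<open>n\<close> iff it is a block of the
  history.\<close>

lemma enat_less_first_waiting_time_iff:
  "enat n < first_waiting_time Z C \<omega> \<longleftrightarrow> avoids C (history Z n \<omega>)"
proof -
  have "enat n < first_waiting_time Z C \<omega> \<longleftrightarrow> (\<forall>A\<in>C. \<forall>m. occurs_at Z A \<omega> m \<longrightarrow> n < m)"
    by (simp add: first_waiting_time_def waiting_time_def le_INF_iff Suc_le_eq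
          flip: Suc_ile_eq)
  also have "\<dots> \<longleftrightarrow> avoids C (history Z n \<omega>)"
    by (auto simp: avoids_def sublist_history_iff occurs_at_iff_suffix not_le[symmetric])
  finally show ?thesis .
qed

lemma enat_eq_iff_less: "x = y \<longleftrightarrow> (\<forall>n. enat n < x \<longleftrightarrow> enat n < y)"
proof
  assume less: "\<forall>n. enat n < x \<longleftrightarrow> enat n < y"
  show "x = y"
  proof (rule ccontr)
    assume "x \<noteq> y"
    then have "x < y \<or> y < x"
      by auto
    with less show False
      by (cases x; cases y) auto
  qed
qed simp

lemma stops_with_pattern_iff:
  assumes "K \<in> C"
  shows "first_waiting_time Z C \<omega> = waiting_time Z K \<omega> \<and> waiting_time Z K \<omega> = enat (Suc n)
    \<longleftrightarrow> completes C K (history Z (Suc n) \<omega>)"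
proof -
  have le: "first_waiting_time Z C \<omega> \<le> waiting_time Z K \<omega>"
    unfolding first_waiting_time_def by (rule INF_lower) (rule assms)
  have single: "waiting_time Z K \<omega> = first_waiting_time Z {K} \<omega>"
    by (simp add: first_waiting_time_def)
  have "first_waiting_time Z C \<omega> = waiting_time Z K \<omega> \<and> waiting_time Z K \<omega> = enat (Suc n)
    \<longleftrightarrow> enat n < first_waiting_time Z C \<omega> \<and> \<not> enat (Suc n) < waiting_time Z K \<omega>"
    using le by (cases "first_waiting_time Z C \<omega>"; cases "waiting_time Z K \<omega>") auto
  also have "\<dots> \<longleftrightarrow> avoids C (history Z n \<omega>) \<and> sublist K (history Z (Suc n) \<omega>)"
    unfolding single enat_less_first_waiting_time_iff by (simp add: avoids_def)
  also have "\<dots> \<longleftrightarrow> completes C K (history Z (Suc n) \<omega>)"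
    using assms by (auto simp: completes_def avoids_def sublist_history_iff le_Suc_eq)
  finally show ?thesis .
qed

section \<open>The first pattern completed by a list\<close>

lemma avoids_sublist: "avoids C ys \<Longrightarrow> sublist xs ys \<Longrightarrow> avoids C xs"
  unfolding avoids_def using sublist_order.order.trans by blast

lemma sublist_butlastI: "suffix K xs \<Longrightarrow> strict_prefix xs ys \<Longrightarrow> sublist K (butlast ys)"
  by (metis prefix_snoc append_butlast_last_id butlast.simps(1) prefix_imp_sublist strict_prefix_def
      sublist_order.order.trans suffix_imp_sublist)

text \<open>Of two patterns ending at the same place, the shorter one is a suffix of the longer one, which
  the assumption on \<open>C\<close> excludes.\<close>

lemma completes_unique_pattern:
  assumes A1: "\<And>K L. K \<in> C \<Longrightarrow> L \<in> C \<Longrightarrow> K \<noteq> L \<Longrightarrow> \<not> sublist K L"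
    and "K \<in> C" "L \<in> C" "completes C K xs" "completes C L xs"
  shows "K = L"
  using assms by (metis completes_def suffix_same_cases suffix_imp_sublist)

text \<open>A pattern completed by a proper prefix is still contained in the longer list without its last
  element, so that the longer list does not complete \<open>C\<close> for the first time.\<close>

lemma completes_unique_time:
  assumes "K \<in> C" "completes C K xs" "completes C L ys" "prefix xs ys"
  shows "xs = ys"
  using assms by (metis completes_def avoids_def sublist_butlastI strict_prefix_def)

text \<open>At the shortest extension of \<open>xs\<close> that contains a pattern, that pattern must end at the
  element added last.\<close>

lemma first_completion_exists:
  assumes "avoids C xs" "\<not> avoids C (xs @ ys)"
  shows "\<exists>K\<in>C. \<exists>r\<in>{1..length ys}. completes C K (xs @ take r ys)"
proof -
  define r where "r = (LEAST r. \<not> avoids C (xs @ take r ys))"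
  have r: "\<not> avoids C (xs @ take r ys)"
    unfolding r_def by (rule LeastI[of _ "length ys"]) (simp add: assms)
  have r_le: "r \<le> length ys"
    unfolding r_def by (rule Least_le) (simp add: assms)
  have "r \<noteq> 0"
    using r assms(1) by (intro notI) simp
  have prev: "avoids C (xs @ take (r - 1) ys)"
    using not_less_Least[of "r - 1" "\<lambda>r. \<not> avoids C (xs @ take r ys)"] \<open>r \<noteq> 0\<close>
    by (auto simp: r_def[symmetric])
  have split: "xs @ take r ys = (xs @ take (r - 1) ys) @ [ys ! (r - 1)]"
    using \<open>r \<noteq> 0\<close> r_le by (cases r) (simp_all add: take_Suc_conv_app_nth)
  obtain K where K: "K \<in> C" "sublist K (xs @ take r ys)"
    using r by (auto simp: avoids_def)
  have "suffix K (xs @ take r ys)"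
    using K prev unfolding split avoids_def by (auto simp: sublist_snoc simp del: append_assoc)
  moreover have "butlast (xs @ take r ys) = xs @ take (r - 1) ys"
    unfolding split by (rule butlast_snoc)
  ultimately show ?thesis
    using K prev \<open>r \<noteq> 0\<close> r_le by (intro bexI[of _ K] bexI[of _ r]) (auto simp: completes_def)
qed

section \<open>Overlaps of patterns\<close>

lemma finite_overlaps [simp]: "finite (overlaps K T)"
  by (simp add: overlaps_def)

lemma overlaps_bounds:
  "r \<in> overlaps K T \<Longrightarrow> 1 \<le> r \<and> r \<le> length K \<and> r \<le> length T"
  by (simp add: overlaps_def)

lemma overlaps_suffix: "r \<in> overlaps K T \<Longrightarrow> suffix (take r T) K"
  unfolding overlaps_def using suffix_drop[of "length K - r" K] by simp

lemma overlaps_last: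
  assumes "r \<in> overlaps K T" "suffix K xs"
  shows "last xs = T ! (r - 1)"
proof -
  have "suffix (take r T) xs"
    using overlaps_suffix assms suffix_order.trans by blast
  moreover have "take r T \<noteq> []"
    using overlaps_bounds[OF assms(1)] by auto
  ultimately have "last xs = last (take r T)"
    by (auto simp: suffix_def)
  also have "\<dots> = T ! (r - 1)"
    using overlaps_bounds[OF assms(1)] \<open>take r T \<noteq> []\<close> by (simp add: last_conv_nth)
  finally show ?thesis .
qed

text \<open>An overlap covering all of \<open>T\<close> exhibits \<open>T\<close> as a suffix of \<open>K\<close>. This is the origin of the term
  $\varepsilon_{KT}$ in $\tilde g_{KT}$.\<close>

lemma overlaps_full_iff:
  assumes A1: "\<And>K L. K \<in> C \<Longrightarrow> L \<in> C \<Longrightarrow> K \<noteq> L \<Longrightarrow> \<not> sublist K L"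
    and "K \<in> C" "T \<in> C" "T \<noteq> []"
  shows "length T \<in> overlaps K T \<longleftrightarrow> K = T"
proof
  assume "length T \<in> overlaps K T"
  then have "suffix T K"
    using overlaps_suffix[of "length T" K T] by simp
  then show "K = T"
    using A1 assms suffix_imp_sublist by blast
next
  assume "K = T"
  then show "length T \<in> overlaps K T"
    using \<open>T \<noteq> []\<close> by (cases T) (auto simp: overlaps_def)
qed

text \<open>When a history without patterns is followed by the pattern \<open>T\<close>, the first completed pattern \<open>K\<close>
  must begin in the old history or together with \<open>T\<close>: otherwise it would lie inside \<open>T\<close>, hence be \<open>T\<close>
  itself, which does not fit. The part of \<open>K\<close> within the block is then an overlap of \<open>K\<close> with \<open>T\<close>.
  The pair of the pattern and the length of its overlap is unique because both the time of first
  completion and the pattern completed then are.\<close>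

lemma first_completion_in_block:
  assumes A1: "\<And>K L. K \<in> C \<Longrightarrow> L \<in> C \<Longrightarrow> K \<noteq> L \<Longrightarrow> \<not> sublist K L"
    and "T \<in> C" "avoids C xs"
  shows "\<exists>!p\<in>(SIGMA K:C. overlaps K T). completes C (fst p) (xs @ take (snd p) T)"
proof -
  have "\<not> avoids C (xs @ T)"
    using \<open>T \<in> C\<close> by (auto simp: avoids_def)
  then obtain K r where K: "K \<in> C" "r \<in> {1..length T}" "completes C K (xs @ take r T)"
    using first_completion_exists[OF \<open>avoids C xs\<close>] by blast
  have suf: "suffix K (xs @ take r T)"
    using K by (simp add: completes_def)
  have block: "suffix (take r T) (xs @ take r T)"
    by (rule suffixI) simp
  have "r \<le> length K"
  proof (rule ccontr)
    assume short: "\<not> r \<le> length K"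
    have "suffix K (take r T)"
      using short K by (intro suffix_length_suffix[OF suf block]) simp
    then have "sublist K T"
      using sublist_order.order.trans suffix_imp_sublist sublist_take by blast
    then have "K = T"
      using A1 K \<open>T \<in> C\<close> by blast
    with short K show False by simp
  qed
  moreover have "drop (length K - r) K = take r T"
  proof -
    have "suffix (take r T) K"
      using \<open>r \<le> length K\<close> by (intro suffix_length_suffix[OF block suf]) simp
    then show ?thesis
      using K by (auto simp: suffix_def)
  qed
  ultimately have mem: "(K, r) \<in> (SIGMA K:C. overlaps K T)"
    using K by (simp add: overlaps_def)
  show ?thesis
  proof (rule ex1I[of _ "(K, r)"])
    fix p assume p: "p \<in> (SIGMA K:C. overlaps K T) \<and> completes C (fst p) (xs @ take (snd p) T)"
    obtain L s where Ls: "p = (L, s)" by (cases p)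
    have L: "L \<in> C" "s \<le> length T" "completes C L (xs @ take s T)"
      using p overlaps_bounds[of s L T] by (auto simp: Ls)
    have "prefix (take r T) (take s T) \<or> prefix (take s T) (take r T)"
      by (metis nat_le_linear take_is_prefix min.absorb1 take_take)
    then have "xs @ take r T = xs @ take s T"
      using completes_unique_time[OF K(1) K(3) L(3)] completes_unique_time[OF L(1) L(3) K(3)] by auto
    then have "r = s"
      using K L by (metis append_same_eq same_append_eq length_take min.absorb2 atLeastAtMost_iff)
    moreover have "K = L"
      using completes_unique_pattern[OF A1 K(1) L(1) K(3)] L(3) \<open>r = s\<close> by blast
    ultimately show "p = (K, r)"
      by (simp add: Ls)
  qed (use mem K in auto)
qed

text \<open>Conversely, if the first completed pattern \<open>K\<close> overlaps \<open>T\<close> in \<open>r\<close> states and the rest of \<open>T\<close>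
  follows, then the whole of \<open>T\<close> can be read off from time \<open>n\<close> on, and no pattern was completed
  by time \<open>n\<close> since \<open>r\<close> is positive.\<close>

lemma completion_followed_by_rest_is_block:
  assumes "r \<in> overlaps K T" "completes C K (take (n + r) ys)" "drop (n + r) ys = drop r T"
    and len: "length ys = n + length T"
  shows "avoids C (take n ys) \<and> drop n ys = T"
proof
  have r: "1 \<le> r" "r \<le> length T"
    using overlaps_bounds[OF assms(1)] by auto
  have "take n ys = take n (butlast (take (n + r) ys))"
    using r len by (simp add: take_butlast min_def)
  then have "sublist (take n ys) (butlast (take (n + r) ys))"
    by (metis sublist_take)
  then show "avoids C (take n ys)"
    using assms(2) avoids_sublist by (auto simp: completes_def)
  have split: "take (n + r) ys = take n ys @ take r (drop n ys)"
    by (simp add: take_add)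
  have "suffix (take r T) (take (n + r) ys)"
    using overlaps_suffix[OF assms(1)] assms(2) suffix_order.trans by (auto simp: completes_def)
  then have "take r (drop n ys) = take r T"
    unfolding split using r len by (auto simp: suffix_def append_eq_append_conv)
  then show "drop n ys = T"
    using assms(3) by (metis append_take_drop_id drop_drop add.commute)
qed

lemma sum_overlaps_eq_g_tilde:
  assumes A1: "\<And>K L. K \<in> C \<Longrightarrow> L \<in> C \<Longrightarrow> K \<noteq> L \<Longrightarrow> \<not> sublist K L"
    and "K \<in> C" "T \<in> C" "T \<noteq> []" and pos: "path_prob P (hd T) (tl T) > 0"
  shows "(\<Sum>r\<in>overlaps K T. path_prob P (T ! (r - 1)) (drop r T)) =
    path_prob P (hd T) (tl T) * g_tilde P K T"
proof -
  define S where "S = {r \<in> overlaps K T. 1 \<le> r \<and> r < length T}"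
  have S: "finite S" "length T \<notin> S"
    by (simp_all add: S_def)
  have "overlaps K T = S \<union> (if K = T then {length T} else {})"
    using overlaps_full_iff[OF A1 assms(2-4)]
    by (auto simp: S_def dest: overlaps_bounds) (metis le_neq_implies_less overlaps_bounds)+
  moreover have "(\<Sum>r\<in>S \<union> (if K = T then {length T} else {}). path_prob P (T ! (r - 1)) (drop r T)) =
      (\<Sum>r\<in>S. path_prob P (T ! (r - 1)) (drop r T)) + (if K = T then 1 else 0)"
    using S by (cases "K = T") simp_all
  ultimately have "(\<Sum>r\<in>overlaps K T. path_prob P (T ! (r - 1)) (drop r T)) =
      (\<Sum>r\<in>S. path_prob P (T ! (r - 1)) (drop r T)) + (if K = T then 1 else 0)"
    by simp
  also have "\<dots> = path_prob P (hd T) (tl T) * g_tilde P K T"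
    using pos by (simp add: g_tilde_def S_def)
  finally show ?thesis .
qed

section \<open>The Markov property for blocks\<close>

lemma path_prob_append:
  "path_prob P x (xs @ ys) = path_prob P x xs * path_prob P (last (x # xs)) ys"
  by (induction xs arbitrary: x) auto

context homogeneous_markov_chain
begin

lemma measurable_history [measurable]: "history Z n \<in> measurable M (count_space UNIV)"
proof (subst measurable_count_space_eq2_countable, intro conjI ballI)
  fix xs :: "'a list"
  have [measurable]: "Z k \<in> measurable M (count_space UNIV)" if "k \<in> {1..n}" for k
    using that Z_measurable by auto
  show "history Z n -` {xs} \<inter> space M \<in> sets M"
  proof (cases "length xs = n")
    case True
    then have "history Z n -` {xs} \<inter> space M = {\<omega>\<in>space M. \<forall>k\<in>{1..n}. Z k \<omega> = xs ! (k - 1)}"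
      by (auto simp: history_eq_iff)
    then show ?thesis by simp
  next
    case False
    then have "history Z n -` {xs} \<inter> space M = {}"
      by auto
    then show ?thesis by simp
  qed
qed auto

lemma history_event: "{\<omega>\<in>space M. Q (history Z n \<omega>)} \<in> events"
  by measurable

text \<open>The law of a finite path. Histories of probability zero, about which the Markov property says
  nothing, stay null when extended.\<close>

lemma prob_path:
  "\<P>(\<omega> in M. history Z (Suc (length ks)) \<omega> = x # ks) = \<mu> x * path_prob P x ks"
proof (induction ks rule: rev_induct)
  case Nil
  have "history Z (Suc 0) \<omega> = [x] \<longleftrightarrow> Z 1 \<omega> = x" for \<omega>
    by (simp add: history_Suc)
  then show ?case
    by (simp add: initial)
next
  case (snoc k ks)
  define n where "n = Suc (length ks)"
  have hist: "(\<forall>i\<in>{1..n}. Z i \<omega> = (x # ks) ! (i - 1)) \<longleftrightarrow> history Z n \<omega> = x # ks" for \<omega>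
    by (subst history_eq_iff) (simp_all add: n_def)
  have lst: "(x # ks) ! (n - 1) = last (x # ks)"
    by (simp add: n_def last_conv_nth)
  have step: "history Z (Suc n) \<omega> = x # ks @ [k] \<longleftrightarrow> Z (Suc n) \<omega> = k \<and> history Z n \<omega> = x # ks" for \<omega>
    unfolding history_Suc by (metis append1_eq_conv append_Cons)
  have "\<P>(\<omega> in M. Z (Suc n) \<omega> = k \<and> history Z n \<omega> = x # ks) =
        \<P>(\<omega> in M. history Z n \<omega> = x # ks) * P (last (x # ks)) k"
  proof (cases "\<P>(\<omega> in M. history Z n \<omega> = x # ks) = 0")
    case True
    have "\<P>(\<omega> in M. Z (Suc n) \<omega> = k \<and> history Z n \<omega> = x # ks) \<le> \<P>(\<omega> in M. history Z n \<omega> = x # ks)"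
      by (intro finite_measure_mono) auto
    with True show ?thesis
      by (simp add: measure_le_0_iff)
  next
    case False
    then have pos: "\<P>(\<omega> in M. history Z n \<omega> = x # ks) > 0"
      by (simp add: zero_less_measure_iff)
    have "\<P>(\<omega> in M. Z (Suc n) \<omega> = k \<bar> history Z n \<omega> = x # ks) = P (last (x # ks)) k"
      using markov[of n "\<lambda>i. (x # ks) ! (i - 1)" k] pos unfolding hist lst by (simp add: n_def)
    with pos show ?thesis
      by (simp add: cond_prob_def field_simps)
  qed
  then have "\<P>(\<omega> in M. history Z (Suc n) \<omega> = x # ks @ [k]) =
      \<P>(\<omega> in M. history Z n \<omega> = x # ks) * P (last (x # ks)) k"
    unfolding step .
  with snoc show ?case
    by (simp add: n_def path_prob_append mult.assoc del: last.simps)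
qed

lemma prob_path_append:
  assumes "xs \<noteq> []"
  shows "\<P>(\<omega> in M. history Z (length xs + length ks) \<omega> = xs @ ks) =
    \<P>(\<omega> in M. history Z (length xs) \<omega> = xs) * path_prob P (last xs) ks"
proof (cases xs)
  case (Cons x ys)
  have "\<P>(\<omega> in M. history Z (length xs + length ks) \<omega> = xs @ ks) = \<mu> x * path_prob P x (ys @ ks)"
    using prob_path[of "ys @ ks" x] by (simp add: Cons)
  then show ?thesis
    using prob_path[of ys x] by (simp add: Cons path_prob_append)
qed (use assms in simp)

text \<open>The Markov property for an event that depends on the first \<open>n\<close> states and fixes the last of
  them. Summing the law of a path over all histories in the event gives the product form, because
  the factor belonging to the block depends on the history only through its last state.\<close>

lemma prob_history_then_block:
  assumes "n \<ge> 1" and last: "\<And>xs. length xs = n \<Longrightarrow> Q xs \<Longrightarrow> last xs = i"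
  shows "\<P>(\<omega> in M. Q (history Z n \<omega>) \<and> drop n (history Z (n + length ks) \<omega>) = ks) =
    \<P>(\<omega> in M. Q (history Z n \<omega>)) * path_prob P i ks"
proof -
  define I where "I = {xs :: 'a list. length xs = n \<and> Q xs}"
  have "finite {xs :: 'a list. length xs = n}"
    using finite_lists_length_eq[of "UNIV :: 'a set" n] by simp
  then have fin: "finite I"
    by (rule rev_finite_subset) (auto simp: I_def)
  have ev: "{\<omega>\<in>space M. Q (history Z n \<omega>) \<and> drop n (history Z (n + length ks) \<omega>) = ks} \<in> events"
    by measurable
  have split: "history Z (n + length ks) \<omega> = xs @ ks \<longleftrightarrow>
      history Z n \<omega> = xs \<and> drop n (history Z (n + length ks) \<omega>) = ks" if "length xs = n" for xs \<omega>
    using take_history[OF le_add1, of n Z "length ks" \<omega>] that by (metis append_eq_conv_conj)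
  have "\<P>(\<omega> in M. Q (history Z n \<omega>) \<and> drop n (history Z (n + length ks) \<omega>) = ks) =
      (\<Sum>xs\<in>I. \<P>(\<omega> in M. history Z (n + length ks) \<omega> = xs @ ks))"
  proof (rule prob_sum[OF fin])
    show "AE \<omega> in M. (\<forall>xs\<in>I. history Z (n + length ks) \<omega> = xs @ ks \<longrightarrow>
          Q (history Z n \<omega>) \<and> drop n (history Z (n + length ks) \<omega>) = ks) \<and>
        (Q (history Z n \<omega>) \<and> drop n (history Z (n + length ks) \<omega>) = ks \<longrightarrow>
          (\<exists>!xs\<in>I. history Z (n + length ks) \<omega> = xs @ ks))"
      using split by (intro AE_I2) (auto simp: I_def intro!: exI[of _ "history Z n _"])
  qed (use ev in \<open>auto intro!: history_event\<close>)
  also have "\<dots> = (\<Sum>xs\<in>I. \<P>(\<omega> in M. history Z n \<omega> = xs) * path_prob P i ks)"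
  proof (rule sum.cong[OF refl])
    fix xs assume "xs \<in> I"
    then have "length xs = n" "last xs = i" "xs \<noteq> []"
      using last \<open>n \<ge> 1\<close> by (auto simp: I_def)
    then show "\<P>(\<omega> in M. history Z (n + length ks) \<omega> = xs @ ks) =
        \<P>(\<omega> in M. history Z n \<omega> = xs) * path_prob P i ks"
      using prob_path_append[of xs ks] by simp
  qed
  also have "\<dots> = \<P>(\<omega> in M. Q (history Z n \<omega>)) * path_prob P i ks"
    unfolding sum_distrib_right[symmetric]
    by (subst prob_sum[OF fin, of "\<lambda>xs \<omega>. history Z n \<omega> = xs" "\<lambda>\<omega>. Q (history Z n \<omega>)"])
       (auto simp: I_def intro: history_event)
  finally show ?thesis .
qed

section \<open>Blocks that start before the first pattern is completed\<close>

lemma prob_avoid_then_block: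
  assumes "ks \<noteq> []" and "n \<ge> 1"
  shows "\<P>(\<omega> in M. avoids C (history Z n \<omega>) \<and> drop n (history Z (n + length ks) \<omega>) = ks) =
    (\<Sum>i\<in>UNIV. \<P>(\<omega> in M. Z n \<omega> = i \<and> avoids C (history Z n \<omega>)) * P i (hd ks)) *
    path_prob P (hd ks) (tl ks)"
proof -
  have [measurable]: "Z n \<in> measurable M (count_space UNIV)"
    using Z_measurable assms by simp
  have pp: "path_prob P i ks = P i (hd ks) * path_prob P (hd ks) (tl ks)" for i
    using assms(1) by (cases ks) auto
  have "\<P>(\<omega> in M. avoids C (history Z n \<omega>) \<and> drop n (history Z (n + length ks) \<omega>) = ks) =
    (\<Sum>i\<in>UNIV. \<P>(\<omega> in M. Z n \<omega> = i \<and> avoids C (history Z n \<omega>) \<and>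
      drop n (history Z (n + length ks) \<omega>) = ks))"
    by (rule prob_sum) auto
  also have "\<dots> = (\<Sum>i\<in>UNIV. \<P>(\<omega> in M. Z n \<omega> = i \<and> avoids C (history Z n \<omega>)) * path_prob P i ks)"
    using prob_history_then_block[OF \<open>n \<ge> 1\<close>, of "\<lambda>xs. last xs = i \<and> avoids C xs" i ks for i]
    by (simp add: last_history[OF \<open>n \<ge> 1\<close>] del: One_nat_def)
  finally show ?thesis
    by (simp add: pp sum_distrib_right mult.assoc)
qed

lemma prob_initial_block:
  assumes "ks \<noteq> []"
  shows "\<P>(\<omega> in M. history Z (length ks) \<omega> = ks) = \<mu> (hd ks) * path_prob P (hd ks) (tl ks)"
  using assms prob_path[of "tl ks" "hd ks"] by (cases ks) auto

text \<open>The tail sum formula $E(\tau) = \sum_n P(\tau > n)$.\<close>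

lemma summable_prob_avoids:
  assumes "(\<integral>\<^sup>+ \<omega>. ennreal_of_enat (first_waiting_time Z C \<omega>) \<partial>M) < \<infinity>"
  shows "summable (\<lambda>n. \<P>(\<omega> in M. avoids C (history Z n \<omega>)))"
proof -
  have "first_waiting_time Z C \<in> measurable M (count_space UNIV)"
  proof (subst measurable_count_space_eq2_countable, intro conjI ballI)
    fix y :: enat
    let ?gt = "\<lambda>n \<omega>. avoids C (history Z n \<omega>)"
    have "first_waiting_time Z C -` {y} \<inter> space M =
      {\<omega>\<in>space M. \<forall>n. ?gt n \<omega> \<longleftrightarrow> enat n < y}"
      by (auto simp: enat_eq_iff_less[of _ y] enat_less_first_waiting_time_iff)
    also have "\<dots> \<in> events"
      by measurable
    finally show "first_waiting_time Z C -` {y} \<inter> space M \<in> events" .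
  qed auto
  from nn_integral_enat_function[OF this] assms
  have "(\<Sum>n. ennreal (\<P>(\<omega> in M. avoids C (history Z n \<omega>)))) < \<infinity>"
    by (simp add: enat_less_first_waiting_time_iff emeasure_eq_measure)
  then show ?thesis
    by (intro summable_suminf_not_top) auto
qed

end

context homogeneous_markov_chain
begin

section \<open>Mean occupation times and stopping probabilities as series\<close>

lemma mean_time_sums:
  assumes "summable (\<lambda>n. \<P>(\<omega> in M. avoids C (history Z n \<omega>)))"
  shows "(\<lambda>n. \<P>(\<omega> in M. Z (Suc n) \<omega> = i \<and> avoids C (history Z (Suc n) \<omega>))) sums mean_time M Z C i"
proof -
  have "summable (\<lambda>n. \<P>(\<omega> in M. avoids C (history Z (Suc n) \<omega>)))"
    using summable_Suc_iff[THEN iffD2, OF assms] .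
  then have "summable (\<lambda>n. \<P>(\<omega> in M. Z (Suc n) \<omega> = i \<and> avoids C (history Z (Suc n) \<omega>)))"
    by (rule summable_comparison_test'[where N = 0])
       (auto intro!: finite_measure_mono history_event)
  then show ?thesis
    unfolding mean_time_def enat_less_first_waiting_time_iff by (rule summable_sums)
qed

lemma stop_prob_sums:
  assumes "summable (\<lambda>n. \<P>(\<omega> in M. avoids C (history Z n \<omega>)))" and "K \<in> C"
  shows "(\<lambda>n. \<P>(\<omega> in M. completes C K (history Z (Suc n) \<omega>))) sums stop_prob M Z C K"
proof -
  have "summable (\<lambda>n. \<P>(\<omega> in M. completes C K (history Z (Suc n) \<omega>)))"
    by (rule summable_comparison_test'[OF assms(1), where N = 0])
       (auto intro!: finite_measure_mono history_event simp: completes_def)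
  then show ?thesis
    unfolding stop_prob_def stops_with_pattern_iff[OF \<open>K \<in> C\<close>] by (rule summable_sums)
qed

text \<open>The terms skipped by starting at time \<open>r\<close> vanish, as a pattern cannot end before its length.
  This allows the time at which a block starts, instead of the time at which it is
  first hit, to be the index of summation.\<close>

lemma stop_prob_sums_shift:
  assumes "summable (\<lambda>n. \<P>(\<omega> in M. avoids C (history Z n \<omega>)))" and "K \<in> C"
    and "1 \<le> r" "r \<le> length K"
  shows "(\<lambda>n. \<P>(\<omega> in M. completes C K (history Z (n + r) \<omega>))) sums stop_prob M Z C K"
proof -
  let ?f = "\<lambda>n. \<P>(\<omega> in M. completes C K (history Z (Suc n) \<omega>))"
  have "?f n = 0" if "n < r - 1" for n
  proof -
    have "\<not> completes C K (history Z (Suc n) \<omega>)" for \<omega>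
      using that \<open>r \<le> length K\<close> suffix_length_le[of K "history Z (Suc n) \<omega>"]
      by (auto simp: completes_def)
    then show ?thesis by simp
  qed
  then have "(\<Sum>n<r - 1. ?f n) = 0"
    by simp
  with stop_prob_sums[OF assms(1,2)] have "(\<lambda>n. ?f (n + (r - 1))) sums stop_prob M Z C K"
    using sums_iff_shift[of ?f "r - 1"] by simp
  with \<open>1 \<le> r\<close> show ?thesis
    by simp
qed

text \<open>The backward computation: the term for time 0 contributes the initial distribution, and the
  other terms add up to the mean occupation times.\<close>

lemma block_prob_sums:
  assumes summable: "summable (\<lambda>n. \<P>(\<omega> in M. avoids C (history Z n \<omega>)))"
    and "[] \<notin> C" and "ks \<noteq> []"
  shows "(\<lambda>n. \<P>(\<omega> in M. avoids C (history Z n \<omega>) \<and> drop n (history Z (n + length ks) \<omega>) = ks)) sums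
    ((\<mu> (hd ks) + (\<Sum>i\<in>UNIV. mean_time M Z C i * P i (hd ks))) * path_prob P (hd ks) (tl ks))"
    (is "?f sums _")
proof -
  have "(\<lambda>n. (\<Sum>i\<in>UNIV. \<P>(\<omega> in M. Z (Suc n) \<omega> = i \<and> avoids C (history Z (Suc n) \<omega>)) * P i (hd ks)) *
      path_prob P (hd ks) (tl ks)) sums
    ((\<Sum>i\<in>UNIV. mean_time M Z C i * P i (hd ks)) * path_prob P (hd ks) (tl ks))"
    by (intro sums_mult2 sums_sum mean_time_sums[OF summable])
  then have "(\<lambda>n. ?f (Suc n)) sums ((\<Sum>i\<in>UNIV. mean_time M Z C i * P i (hd ks)) * path_prob P (hd ks) (tl ks))"
    by (subst prob_avoid_then_block[OF \<open>ks \<noteq> []\<close>]) simp_all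
  then have "?f sums ((\<Sum>i\<in>UNIV. mean_time M Z C i * P i (hd ks)) * path_prob P (hd ks) (tl ks) + ?f 0)"
    by (rule sums_Suc)
  moreover have "?f 0 = \<mu> (hd ks) * path_prob P (hd ks) (tl ks)"
  proof -
    have "avoids C []"
      using \<open>[] \<notin> C\<close> by (auto simp: avoids_def)
    then show ?thesis
      using prob_initial_block[OF \<open>ks \<noteq> []\<close>] by simp
  qed
  ultimately show ?thesis
    by (simp add: algebra_simps)
qed

section \<open>Splitting at the first completed pattern\<close>

lemma prob_step_split:
  assumes "finite C"
    and A1: "\<And>K L. K \<in> C \<Longrightarrow> L \<in> C \<Longrightarrow> K \<noteq> L \<Longrightarrow> \<not> sublist K L"
    and "[] \<notin> C"
  shows "\<P>(\<omega> in M. avoids C (history Z n \<omega>) \<and> Z (Suc n) \<omega> = j) =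
    \<P>(\<omega> in M. Z (Suc n) \<omega> = j \<and> avoids C (history Z (Suc n) \<omega>)) +
    (\<Sum>K\<in>C. \<P>(\<omega> in M. completes C K (history Z (Suc n) \<omega>)) * ends_in K j)"
proof -
  define stop where "stop \<omega> \<longleftrightarrow> Z (Suc n) \<omega> = j \<and> avoids C (history Z n \<omega>) \<and>
    \<not> avoids C (history Z (Suc n) \<omega>)" for \<omega>
  have [measurable]: "Z (Suc n) \<in> measurable M (count_space UNIV)"
    using Z_measurable by simp
  have [measurable]: "{\<omega>\<in>space M. stop \<omega>} \<in> events"
    unfolding stop_def by measurable
  have avoids_Suc: "avoids C (history Z (Suc n) \<omega>) \<Longrightarrow> avoids C (history Z n \<omega>)" for \<omega>
    unfolding history_Suc by (erule avoids_sublist) simp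
  have completes_last: "last K = Z (Suc n) \<omega>"
    if "K \<in> C" "completes C K (history Z (Suc n) \<omega>)" for K \<omega>
  proof -
    have "K \<noteq> []"
      using that \<open>[] \<notin> C\<close> by auto
    then show ?thesis
      using that last_history[of "Suc n" Z \<omega>] by (auto simp: completes_def suffix_def)
  qed
  have completes_stops: "avoids C (history Z n \<omega>) \<and> \<not> avoids C (history Z (Suc n) \<omega>)"
    if "K \<in> C" "completes C K (history Z (Suc n) \<omega>)" for K \<omega>
    using that by (auto simp: completes_def avoids_def)
  have stops_completes: "\<exists>K\<in>C. completes C K (history Z (Suc n) \<omega>)"
    if "avoids C (history Z n \<omega>)" "\<not> avoids C (history Z (Suc n) \<omega>)" for \<omega>
    using first_completion_exists[of C "history Z n \<omega>" "[Z (Suc n) \<omega>]"] that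
    by (simp add: history_Suc)
  have "\<P>(\<omega> in M. stop \<omega>) =
    (\<Sum>K\<in>{K\<in>C. last K = j}. \<P>(\<omega> in M. completes C K (history Z (Suc n) \<omega>)))"
  proof (rule prob_sum)
    show "AE \<omega> in M. (\<forall>K\<in>{K\<in>C. last K = j}. completes C K (history Z (Suc n) \<omega>) \<longrightarrow> stop \<omega>) \<and>
        (stop \<omega> \<longrightarrow> (\<exists>!K\<in>{K\<in>C. last K = j}. completes C K (history Z (Suc n) \<omega>)))"
    proof (intro AE_I2 conjI ballI impI)
      fix \<omega> K assume "K \<in> {K\<in>C. last K = j}" "completes C K (history Z (Suc n) \<omega>)"
      then show "stop \<omega>"
        using completes_last completes_stops by (auto simp: stop_def)
    next
      fix \<omega> assume "stop \<omega>"
      then obtain K where "K \<in> C" "completes C K (history Z (Suc n) \<omega>)" "Z (Suc n) \<omega> = j"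
        using stops_completes by (auto simp: stop_def)
      then show "\<exists>!K\<in>{K\<in>C. last K = j}. completes C K (history Z (Suc n) \<omega>)"
        using completes_last completes_unique_pattern[OF A1] by (intro ex1I[of _ K]) auto
    qed
  qed (use \<open>finite C\<close> in \<open>auto intro: history_event\<close>)
  also have "\<dots> = (\<Sum>K\<in>C. \<P>(\<omega> in M. completes C K (history Z (Suc n) \<omega>)) * ends_in K j)"
    using \<open>finite C\<close> by (auto simp: ends_in_def sum.inter_filter if_distrib cong: if_cong)
  moreover have "{\<omega>\<in>space M. avoids C (history Z n \<omega>) \<and> Z (Suc n) \<omega> = j} =
      {\<omega>\<in>space M. Z (Suc n) \<omega> = j \<and> avoids C (history Z (Suc n) \<omega>)} \<union> {\<omega>\<in>space M. stop \<omega>}"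
    using avoids_Suc by (auto simp: stop_def)
  then have "\<P>(\<omega> in M. avoids C (history Z n \<omega>) \<and> Z (Suc n) \<omega> = j) =
      \<P>(\<omega> in M. Z (Suc n) \<omega> = j \<and> avoids C (history Z (Suc n) \<omega>)) + \<P>(\<omega> in M. stop \<omega>)"
    by (simp only:) (subst finite_measure_Union; auto simp: stop_def)
  ultimately show ?thesis by simp
qed

text \<open>The forward computation for a pattern \<open>T\<close>: the event is split according to the pattern completed
  first and its overlap with \<open>T\<close>, and the Markov property is applied at the time of
  completion, where the current state is the \<open>r\<close>-th state of \<open>T\<close>.\<close>

lemma prob_block_split:
  assumes "finite C"
    and A1: "\<And>K L. K \<in> C \<Longrightarrow> L \<in> C \<Longrightarrow> K \<noteq> L \<Longrightarrow> \<not> sublist K L"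
    and "T \<in> C"
  shows "\<P>(\<omega> in M. avoids C (history Z n \<omega>) \<and> drop n (history Z (n + length T) \<omega>) = T) =
    (\<Sum>K\<in>C. \<Sum>r\<in>overlaps K T. \<P>(\<omega> in M. completes C K (history Z (n + r) \<omega>)) *
      path_prob P (T ! (r - 1)) (drop r T))"
proof -
  define I where "I = (SIGMA K:C. overlaps K T)"
  let ?B = "\<lambda>\<omega>. avoids C (history Z n \<omega>) \<and> drop n (history Z (n + length T) \<omega>) = T"
  let ?E = "\<lambda>p \<omega>. completes C (fst p) (history Z (n + snd p) \<omega>) \<and>
    drop (n + snd p) (history Z (n + length T) \<omega>) = drop (snd p) T"
  have "\<P>(\<omega> in M. ?B \<omega>) = (\<Sum>p\<in>I. \<P>(\<omega> in M. ?E p \<omega>))"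
  proof (rule prob_sum)
    show "finite I"
      using \<open>finite C\<close> by (simp add: I_def)
    show "AE \<omega> in M. (\<forall>p\<in>I. ?E p \<omega> \<longrightarrow> ?B \<omega>) \<and> (?B \<omega> \<longrightarrow> (\<exists>!p\<in>I. ?E p \<omega>))"
    proof (intro AE_I2 conjI ballI impI)
      fix \<omega> p assume p: "p \<in> I" and E: "?E p \<omega>"
      have r: "snd p \<in> overlaps (fst p) T"
        using p by (auto simp: I_def)
      then show "avoids C (history Z n \<omega>)" "drop n (history Z (n + length T) \<omega>) = T"
        using completion_followed_by_rest_is_block[OF r, of C n "history Z (n + length T) \<omega>"] E overlaps_bounds[OF r]
        by (simp_all add: take_history)
    next
      fix \<omega> assume B: "?B \<omega>"
      have "history Z (n + length T) \<omega> = history Z n \<omega> @ T"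
        using B take_history[OF le_add1, of n Z "length T" \<omega>] by (metis append_take_drop_id)
      then have "history Z (n + r) \<omega> = history Z n \<omega> @ take r T"
        "drop (n + r) (history Z (n + length T) \<omega>) = drop r T" if "r \<le> length T" for r
        using that take_history[of "n + r" "n + length T" Z \<omega>] by auto
      then have "p \<in> I \<and> ?E p \<omega> \<longleftrightarrow> p \<in> I \<and> completes C (fst p) (history Z n \<omega> @ take (snd p) T)" for p
        using overlaps_bounds[of "snd p" "fst p" T] by (auto simp: I_def)
      then show "\<exists>!p\<in>I. ?E p \<omega>"
        using first_completion_in_block[OF A1 \<open>T \<in> C\<close>, of "history Z n \<omega>"] B
        unfolding I_def[symmetric] by simp
    qed
  qed measurable
  also have "\<dots> = (\<Sum>p\<in>I. \<P>(\<omega> in M. completes C (fst p) (history Z (n + snd p) \<omega>)) *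
      path_prob P (T ! (snd p - 1)) (drop (snd p) T))"
  proof (rule sum.cong[OF refl])
    fix p assume "p \<in> I"
    then have r: "snd p \<in> overlaps (fst p) T"
      by (auto simp: I_def)
    have "\<P>(\<omega> in M. completes C (fst p) (history Z (n + snd p) \<omega>) \<and>
        drop (n + snd p) (history Z (n + snd p + length (drop (snd p) T)) \<omega>) = drop (snd p) T) =
      \<P>(\<omega> in M. completes C (fst p) (history Z (n + snd p) \<omega>)) *
      path_prob P (T ! (snd p - 1)) (drop (snd p) T)"
      using overlaps_bounds[OF r] overlaps_last[OF r]
      by (intro prob_history_then_block) (auto simp: completes_def)
    then show "\<P>(\<omega> in M. ?E p \<omega>) = \<P>(\<omega> in M. completes C (fst p) (history Z (n + snd p) \<omega>)) *
      path_prob P (T ! (snd p - 1)) (drop (snd p) T)"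
      using overlaps_bounds[OF r] by simp
  qed
  finally show ?thesis
    using \<open>finite C\<close> by (simp add: I_def sum.Sigma split_beta)
qed

section \<open>The two systems of equations\<close>

lemma mean_time_balance:
  assumes "finite C" "[] \<notin> C"
    and A1: "\<And>K L. K \<in> C \<Longrightarrow> L \<in> C \<Longrightarrow> K \<noteq> L \<Longrightarrow> \<not> sublist K L"
    and summable: "summable (\<lambda>n. \<P>(\<omega> in M. avoids C (history Z n \<omega>)))"
  shows "(\<Sum>i\<in>UNIV. mean_time M Z C i * P i j)
    = mean_time M Z C j + (\<Sum>K\<in>C. stop_prob M Z C K * ends_in K j) - \<mu> j"
proof -
  have last_step: "drop n (history Z (Suc n) \<omega>) = [j] \<longleftrightarrow> Z (Suc n) \<omega> = j" for n \<omega>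
    by (simp add: history_Suc)
  have split: "\<P>(\<omega> in M. avoids C (history Z n \<omega>) \<and> Z (Suc n) \<omega> = j) =
      \<P>(\<omega> in M. Z (Suc n) \<omega> = j \<and> avoids C (history Z (Suc n) \<omega>)) +
      (\<Sum>K\<in>C. \<P>(\<omega> in M. completes C K (history Z (Suc n) \<omega>)) * ends_in K j)" for n
    by (rule prob_step_split) (use assms in blast)+
  have "(\<lambda>n. \<P>(\<omega> in M. avoids C (history Z n \<omega>) \<and> Z (Suc n) \<omega> = j)) sums
      (\<mu> j + (\<Sum>i\<in>UNIV. mean_time M Z C i * P i j))"
    using block_prob_sums[OF summable \<open>[] \<notin> C\<close>, of "[j]"] by (simp add: last_step)
  moreover have "(\<lambda>n. \<P>(\<omega> in M. avoids C (history Z n \<omega>) \<and> Z (Suc n) \<omega> = j)) sums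
      (mean_time M Z C j + (\<Sum>K\<in>C. stop_prob M Z C K * ends_in K j))"
    unfolding split
    by (intro sums_add sums_sum sums_mult2 mean_time_sums stop_prob_sums summable)
  ultimately show ?thesis
    using sums_unique2 by fastforce
qed

lemma mean_time_pattern_equation:
  assumes "finite C" "[] \<notin> C"
    and A1: "\<And>K L. K \<in> C \<Longrightarrow> L \<in> C \<Longrightarrow> K \<noteq> L \<Longrightarrow> \<not> sublist K L"
    and summable: "summable (\<lambda>n. \<P>(\<omega> in M. avoids C (history Z n \<omega>)))"
    and "T \<in> C" and pos: "path_prob P (hd T) (tl T) > 0"
  shows "(\<Sum>i\<in>UNIV. mean_time M Z C i * P i (hd T))
    = (\<Sum>K\<in>C. stop_prob M Z C K * g_tilde P K T) - \<mu> (hd T)"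
proof -
  let ?p = "path_prob P (hd T) (tl T)"
  have "T \<noteq> []"
    using assms by auto
  have split: "\<P>(\<omega> in M. avoids C (history Z n \<omega>) \<and> drop n (history Z (n + length T) \<omega>) = T) =
      (\<Sum>K\<in>C. \<Sum>r\<in>overlaps K T. \<P>(\<omega> in M. completes C K (history Z (n + r) \<omega>)) *
        path_prob P (T ! (r - 1)) (drop r T))" for n
    by (rule prob_block_split) (use assms in blast)+
  have "(\<lambda>n. \<P>(\<omega> in M. avoids C (history Z n \<omega>) \<and> drop n (history Z (n + length T) \<omega>) = T)) sums
      ((\<mu> (hd T) + (\<Sum>i\<in>UNIV. mean_time M Z C i * P i (hd T))) * ?p)"
    by (rule block_prob_sums[OF summable \<open>[] \<notin> C\<close> \<open>T \<noteq> []\<close>])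
  moreover have "(\<lambda>n. \<P>(\<omega> in M. avoids C (history Z n \<omega>) \<and> drop n (history Z (n + length T) \<omega>) = T)) sums
      (\<Sum>K\<in>C. \<Sum>r\<in>overlaps K T. stop_prob M Z C K * path_prob P (T ! (r - 1)) (drop r T))"
    unfolding split
    by (intro sums_sum sums_mult2 stop_prob_sums_shift summable) (auto dest: overlaps_bounds)
  ultimately have "(\<mu> (hd T) + (\<Sum>i\<in>UNIV. mean_time M Z C i * P i (hd T))) * ?p =
      (\<Sum>K\<in>C. \<Sum>r\<in>overlaps K T. stop_prob M Z C K * path_prob P (T ! (r - 1)) (drop r T))"
    by (rule sums_unique2)
  also have "\<dots> = (\<Sum>K\<in>C. stop_prob M Z C K * g_tilde P K T) * ?p"
    unfolding sum_distrib_left[symmetric] sum_distrib_right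
    using sum_overlaps_eq_g_tilde[OF A1 _ \<open>T \<in> C\<close> \<open>T \<noteq> []\<close> pos]
    by (intro sum.cong refl) simp
  finally show ?thesis
    using pos by simp
qed

end

theorem corollary2p3:
  fixes M :: "'w measure"
    and Z :: "nat \<Rightarrow> 'w \<Rightarrow> 'a::finite"
    and \<mu> :: "'a \<Rightarrow> real"
    and P :: "'a \<Rightarrow> 'a \<Rightarrow> real"
    and C :: "'a list set"
  assumes chain: "homogeneous_markov_chain M Z \<mu> P"
    and finite_C: "finite C"
    and nonempty_patterns: "\<And>K. K \<in> C \<Longrightarrow> length K \<ge> 1"
    and A1: "\<And>K L. K \<in> C \<Longrightarrow> L \<in> C \<Longrightarrow> K \<noteq> L \<Longrightarrow> \<not> sublist K L"
    and A2: "\<And>K. K \<in> C \<Longrightarrow> path_prob P (hd K) (tl K) > 0"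
    and A3_finite: "\<P>(\<omega> in M. first_waiting_time Z C \<omega> < \<infinity>) = 1"
    and A3_mean: "(\<integral>\<^sup>+ \<omega>. ennreal_of_enat (first_waiting_time Z C \<omega>) \<partial>M) < \<infinity>"
  shows "(\<forall>j. (\<Sum>i\<in>UNIV. mean_time M Z C i * P i j)
             = mean_time M Z C j + (\<Sum>K\<in>C. stop_prob M Z C K * ends_in K j) - \<mu> j) \<and>
         (\<forall>T\<in>C. (\<Sum>i\<in>UNIV. mean_time M Z C i * P i (hd T))
             = (\<Sum>K\<in>C. stop_prob M Z C K * g_tilde P K T) - \<mu> (hd T))"
proof -
  interpret homogeneous_markov_chain M Z \<mu> P
    by (rule chain)
  have nonempty: "[] \<notin> C"
    using nonempty_patterns by fastforce
  note balance = finite_C nonempty A1 summable_prob_avoids[OF A3_mean]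
  show ?thesis
    using mean_time_balance[OF balance] mean_time_pattern_equation[OF balance _ A2] by blast
qed

end
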